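(* For every integer $i>0$ there exists a solution to a peg solitaire problem on $\mathsf{Rhombus}(6i)$ whose last move is a maximal sweep, of length $(9i-1)(3i-1)$. That is, for every integer $i\ge 1$ there are a hole $v$ of $\mathsf{Rhombus}(6i)$ and a finite sequence of moves which starts from the position in which every hole except $v$ contains a peg, ends in a position with exactly one peg, and has as its last move a sweep of length $(9i-1)(3i-1)$, this being the longest length of any sweep geometrically possible on $\mathsf{Rhombus}(6i)$.
   Context: Board: for $n\ge 1$, $\mathsf{Rhombus}(n)$ is the rhombus-shaped peg solitaire board with $n$ holes on each side on a triangular lattice. Equivalently, its holes are the pairs $(x,y)$ of integers with $1\le x,y\le n$, and the six lattice directions are $\pm(1,0),\ \pm(0,1),\ \pm(1,1)$ (an $n\times n$ square board with jumps additionally allowed along one of the two diagonal directions). Position: a board position is a subset of the holes, namely those holes that contain a peg; each hole contains at most one peg. Jump: if $d$ is one of the six directions, $p$, $p+d$, $p+2d$ are all holes of the board, $p$ and $p+d$ contain pegs and $p+2d$ is empty, then the peg at $p$ may jump to $p+2d$; the peg at $p+d$ is removed, so afterwards $p$ and $p+d$ are empty and $p+2d$ contains a peg. Move and sweep: a move is a sequence of one or more consecutive jumps made by the same peg (each jump after the first starts at the hole where the preceding jump ended). A single move that captures $m$ pegs (i.e. consists of $m$ jumps) is called a sweep of length $m$, or an $m$-sweep. A sweep is called maximal on a board if its length is the longest geometrically possible on that board, i.e. the largest length of a sweep that can be made starting from any board position whatsoever (whether or not that position can be reached in a game). Peg solitaire problem: the problem of going from a board position in which all holes but one contain a peg to a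 position with exactly one peg, by a sequence of moves; such a sequence of moves is a solution. *)

theory Defs
  imports Main "HOL-Library.Product_Plus"
begin

type_synonym hole = "int \<times> int"
type_synonym position = "hole set"

definition rhombus :: "nat \<Rightarrow> hole set" where
  "rhombus n = {1..int n} \<times> {1..int n}"

definition directions :: "hole set" where
  "directions = {(1, 0), (-1, 0), (0, 1), (0, -1), (1, 1), (-1, -1)}"

text \<open>\<open>jump B P p q Q\<close>: on the board \<open>B\<close>, the peg at \<open>p\<close> may jump to \<open>q\<close>, which turns the
  position \<open>P\<close> into \<open>Q\<close>. Addition of holes is componentwise.\<close>

definition jump :: "hole set \<Rightarrow> position \<Rightarrow> hole \<Rightarrow> hole \<Rightarrow> position \<Rightarrow> bool" where
  "jump B P p q Q \<longleftrightarrow>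
     (\<exists>d\<in>directions. q = p + d + d \<and> p \<in> B \<and> p + d \<in> B \<and> q \<in> B \<and>
        p \<in> P \<and> p + d \<in> P \<and> q \<notin> P \<and> Q = insert q (P - {p, p + d}))"

text \<open>A move is represented by the list of holes visited by the moving peg, including
  the hole from which it starts; such a list has at least two entries.\<close>

inductive peg_move :: "hole set \<Rightarrow> position \<Rightarrow> hole list \<Rightarrow> position \<Rightarrow> bool" for B where
  single: "jump B P p q Q \<Longrightarrow> peg_move B P [p, q] Q"
| more: "jump B P p q Q \<Longrightarrow> peg_move B Q (q # hs) R \<Longrightarrow> peg_move B P (p # q # hs) R"

inductive play :: "hole set \<Rightarrow> position \<Rightarrow> hole list list \<Rightarrow> position \<Rightarrow> bool" for B where
  Nil: "play B P [] P"
| Cons: "peg_move B P s Q \<Longrightarrow> play B Q ss R \<Longrightarrow> play B P (s # ss) R"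

definition solution :: "hole set \<Rightarrow> hole \<Rightarrow> hole list list \<Rightarrow> bool" where
  "solution B v ss \<longleftrightarrow> v \<in> B \<and> (\<exists>h. play B (B - {v}) ss {h})"

text \<open>The number of jumps, i.e. of captured pegs.\<close>

definition sweep_length :: "hole list \<Rightarrow> nat" where
  "sweep_length s = length s - 1"

text \<open>The starting position is arbitrary and need not be reachable in a game.\<close>

definition possible_sweep :: "hole set \<Rightarrow> hole list \<Rightarrow> bool" where
  "possible_sweep B s \<longleftrightarrow> (\<exists>P Q. P \<subseteq> B \<and> peg_move B P s Q)"

definition maximal_sweep :: "hole set \<Rightarrow> hole list \<Rightarrow> bool" where
  "maximal_sweep B s \<longleftrightarrow> possible_sweep B s \<and>
     (\<forall>s'. possible_sweep B s' \<longrightarrow> sweep_length s' \<le> sweep_length s)"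

end

(* The longest sweep is an Euler trail in the grid of holes that have the parity of the starting
   hole; the captured holes are the midpoints of its edges. Starting from (1, 1), the trail alternates
   between rows, swept to the right, and zigzags between neighbouring rows, swept to the left.

   A jump read backwards is a jump on complements, so it remains to reduce the complement of the
   position before the sweep to a single peg. This complement consists of the top row, the last
   column and the sparse lattice of holes with odd coordinates. A peg next to the end of a line of
   the lattice clears the whole line. The pegs of the last column do so with the rows, down to
   the 6 x 6 blocks on the diagonal. Then the blocks are removed one by one from the top right
   corner downwards, each together with the columns and the part of the top row above it; the
   last peg clears the bottom row. The jumps inside a block were found by computer search. *)

theory Submission
  imports Defs
begin

subsection \<open>Sequences of single jumps\<close>

inductive reach :: "hole set \<Rightarrow> position \<Rightarrow> position \<Rightarrow> bool" for B where
  refl: "reach B P P"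
| step: "jump B P p q Q \<Longrightarrow> reach B Q R \<Longrightarrow> reach B P R"

lemma reach_trans [trans]: "reach B P Q \<Longrightarrow> reach B Q R \<Longrightarrow> reach B P R"
  by (induction rule: reach.induct) (auto intro: reach.step)

lemma reach_jump: "jump B P p q Q \<Longrightarrow> reach B P Q"
  by (blast intro: reach.intros)

text \<open>A jump inspects and changes only its three holes, all in \<open>F\<close>, so pegs
  outside \<open>F\<close> are carried along unchanged.\<close>

lemma jump_frame:
  assumes "jump F P p q Q" "F \<subseteq> B" "R \<inter> F = {}"
  shows "jump B (P \<union> R) p q (Q \<union> R)"
proof -
  from assms(1) obtain d where d: "d \<in> directions" "q = p + d + d" "p \<in> F" "p + d \<in> F" "q \<in> F"
    "p \<in> P" "p + d \<in> P" "q \<notin> P" "Q = insert q (P - {p, p + d})"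
    unfolding jump_def by blast
  have "p \<notin> R" "p + d \<notin> R" "q \<notin> R" using d assms(3) by blast+
  then show ?thesis
    unfolding jump_def using d assms(2) by (intro bexI[of _ d]) auto
qed

lemma reach_frame:
  assumes "reach F P Q" "F \<subseteq> B" "R \<inter> F = {}"
  shows "reach B (P \<union> R) (Q \<union> R)"
  using assms by (induction rule: reach.induct) (auto intro: reach.intros jump_frame)

text \<open>With both decompositions as equations, each link of a calculation names only the
  bystanders \<open>R\<close> and leaves set identities.\<close>

lemma reach_step:
  assumes "reach F X Y" "F \<subseteq> B" "P = X \<union> R" "Q = Y \<union> R" "R \<inter> F = {}"
  shows "reach B P Q"
  using reach_frame assms by simp

lemma reach_mono: "reach F P Q \<Longrightarrow> F \<subseteq> B \<Longrightarrow> reach B P Q"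
  using reach_frame[of F P Q B "{}"] by simp

section \<open>Translations, disjoint unions and complements\<close>

lemma jump_translate:
  assumes "jump F P p q Q"
  shows "jump ((+) t ` F) ((+) t ` P) (t + p) (t + q) ((+) t ` Q)"
proof -
  from assms obtain d where d: "d \<in> directions" "q = p + d + d" "p \<in> F" "p + d \<in> F" "q \<in> F"
    "p \<in> P" "p + d \<in> P" "q \<notin> P" "Q = insert q (P - {p, p + d})"
    unfolding jump_def by blast
  have "(+) t ` (insert q (P - {p, p + d})) = insert (t + q) ((+) t ` P - {t + p, t + (p + d)})"
    by (auto simp: image_iff)
  then show ?thesis
    unfolding jump_def using d by (intro bexI[of _ d]) (auto simp: add.assoc)
qed

lemma reach_translate:
  "reach F P Q \<Longrightarrow> reach ((+) t ` F) ((+) t ` P) ((+) t ` Q)"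
  by (induction rule: reach.induct) (auto intro: reach.intros jump_translate)

text \<open>Pairwise disjoint regions cannot interfere, so their jumps may be made one region after
  another.\<close>

lemma reach_UN:
  assumes "finite I" "\<And>i. i \<in> I \<Longrightarrow> reach (F i) (X i) (Y i)"
    "\<And>i. i \<in> I \<Longrightarrow> X i \<subseteq> F i" "\<And>i. i \<in> I \<Longrightarrow> Y i \<subseteq> F i"
    "\<And>i j. i \<in> I \<Longrightarrow> j \<in> I \<Longrightarrow> i \<noteq> j \<Longrightarrow> F i \<inter> F j = {}"
  shows "reach (\<Union>i\<in>I. F i) (\<Union>i\<in>I. X i) (\<Union>i\<in>I. Y i)"
  using assms
proof (induction I rule: finite_induct)
  case empty
  then show ?case by (simp add: reach.refl)
next
  case (insert i I)
  have disj: "F i \<inter> (\<Union>j\<in>I. F j) = {}"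
    using insert.prems(4) insert.hyps(2) by fastforce
  have sub: "X i \<subseteq> F i" "(\<Union>j\<in>I. Y j) \<subseteq> (\<Union>j\<in>I. F j)"
    using insert.prems(2,3) by blast+
  have X: "X i \<inter> (\<Union>j\<in>I. F j) = {}" and Y: "(\<Union>j\<in>I. Y j) \<inter> F i = {}"
    using disj sub by blast+
  have IH: "reach (\<Union>j\<in>I. F j) (\<Union>j\<in>I. X j) (\<Union>j\<in>I. Y j)"
    by (rule insert.IH) (simp_all add: insert.prems)
  have "reach (\<Union>j\<in>insert i I. F j) ((\<Union>j\<in>I. X j) \<union> X i) ((\<Union>j\<in>I. Y j) \<union> X i)"
    using IH _ X by (rule reach_frame) blast
  also have "(\<Union>j\<in>I. Y j) \<union> X i = X i \<union> (\<Union>j\<in>I. Y j)" by (rule Un_commute)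
  also have "reach (\<Union>j\<in>insert i I. F j) (X i \<union> (\<Union>j\<in>I. Y j)) (Y i \<union> (\<Union>j\<in>I. Y j))"
    using insert.prems(1)[OF insertI1] _ Y by (rule reach_frame) blast
  finally show ?case by (simp add: Un_commute)
qed

text \<open>A jump turns peg, peg, empty into empty, empty, peg. With pegs and empty holes
  exchanged, the same jump leads from the later pattern to the earlier one.\<close>

lemma jump_complement:
  assumes "jump B P p q Q" "P \<subseteq> B"
  shows "jump B (B - Q) p q (B - P)"
proof -
  from assms(1) obtain d where d: "d \<in> directions" "q = p + d + d" "p \<in> B" "p + d \<in> B" "q \<in> B"
    "p \<in> P" "p + d \<in> P" "q \<notin> P" "Q = insert q (P - {p, p + d})"
    unfolding jump_def by blast
  have "p \<noteq> q" "p + d \<noteq> q" using d by metis+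
  then show ?thesis
    unfolding jump_def using d assms(2) by (intro bexI[of _ d]) auto
qed

lemma reach_complement: "reach B P Q \<Longrightarrow> P \<subseteq> B \<Longrightarrow> reach B (B - Q) (B - P)"
proof (induction rule: reach.induct)
  case (refl P)
  then show ?case by (simp add: reach.refl)
next
  case (step P p q Q R)
  have "Q \<subseteq> B" using step.hyps(1) step.prems unfolding jump_def by auto
  with step.IH have "reach B (B - R) (B - Q)" by blast
  also have "reach B (B - Q) (B - P)"
    using jump_complement[OF step.hyps(1) step.prems] by (rule reach_jump)
  finally show ?case .
qed

lemma reach_play_append:
  assumes "reach B P Q" "play B Q ss R"
  shows "\<exists>ts. play B P (ts @ ss) R"
  using assms
proof (induction rule: reach.induct)
  case (refl P)
  then show ?case by (metis append_Nil)
next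
  case (step P p q Q R')
  then obtain ts where "play B Q (ts @ ss) R" by blast
  then have "play B P (([p, q] # ts) @ ss) R"
    using play.Cons[OF peg_move.single[OF step.hyps(1)]] by simp
  then show ?case by blast
qed

subsection \<open>Explicit sequences of jumps\<close>

text \<open>Positions as lists make concrete jump sequences computable. The board is not tested
  here; \<open>touched\<close> collects the holes for that.\<close>

fun exec :: "(hole \<times> hole) list \<Rightarrow> hole list \<Rightarrow> hole list option" where
  "exec [] P = Some P"
| "exec ((p, d) # js) P =
     (if p \<in> set P \<and> p + d \<in> set P \<and> p + d + d \<notin> set P \<and> d \<in> directions
      then exec js ((p + d + d) # filter (\<lambda>h. h \<noteq> p \<and> h \<noteq> p + d) P) else None)"

fun touched :: "(hole \<times> hole) list \<Rightarrow> hole list" where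
  "touched [] = []"
| "touched ((p, d) # js) = p # (p + d) # (p + d + d) # touched js"

lemma exec_reach: "exec js P = Some Q \<Longrightarrow> set (touched js) \<subseteq> B \<Longrightarrow> reach B (set P) (set Q)"
proof (induction js P rule: exec.induct)
  case (1 P)
  then show ?case by (simp add: reach.refl)
next
  case (2 p d js P)
  let ?P = "(p + d + d) # filter (\<lambda>h. h \<noteq> p \<and> h \<noteq> p + d) P"
  have c: "p \<in> set P" "p + d \<in> set P" "p + d + d \<notin> set P" "d \<in> directions" "exec js ?P = Some Q"
    using 2(2) by (auto split: if_splits)
  have "jump B (set P) p (p + d + d) (set ?P)"
    unfolding jump_def using c 2(3) by (intro bexI[of _ d]) auto
  moreover have "reach B (set ?P) (set Q)" by (rule 2(1)) (use c 2(3) in auto)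
  ultimately show ?case by (rule reach.step)
qed

subsection \<open>Sweeps\<close>

text \<open>Unlike \<open>peg_move\<close>, zero jumps are allowed and both ends are recorded, so
  that pieces of a trail can be concatenated.\<close>

inductive sweeps :: "hole set \<Rightarrow> position \<Rightarrow> hole \<Rightarrow> hole \<Rightarrow> nat \<Rightarrow> position \<Rightarrow> bool" for B where
  nil: "sweeps B P p p 0 P"
| cons: "jump B P p r Q \<Longrightarrow> sweeps B Q r q k R \<Longrightarrow> sweeps B P p q (Suc k) R"

lemma sweeps_trans:
  "sweeps B P p q k Q \<Longrightarrow> sweeps B Q q r l R \<Longrightarrow> sweeps B P p r (k + l) R"
  by (induction rule: sweeps.induct) (auto intro: sweeps.intros)

lemma sweeps_snoc: "sweeps B P p q k Q \<Longrightarrow> jump B Q q r R \<Longrightarrow> sweeps B P p r (Suc k) R"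
  using sweeps_trans[of B P p q k Q r 1 R] by (auto intro: sweeps.intros)

lemma sweeps_reach: "sweeps B P p q k Q \<Longrightarrow> reach B P Q"
  by (induction rule: sweeps.induct) (auto intro: reach.intros)

lemma sweeps_peg_move:
  "sweeps B P p q k Q \<Longrightarrow> k > 0 \<Longrightarrow> \<exists>hs. peg_move B P (p # hs) Q \<and> length hs = k"
proof (induction rule: sweeps.induct)
  case (nil P p)
  then show ?case by simp
next
  case (cons P p r Q q k R)
  show ?case
  proof (cases k)
    case 0
    with cons.hyps(2) have "R = Q" by (auto elim: sweeps.cases)
    with peg_move.single[OF cons.hyps(1)] show ?thesis
      using 0 by (intro exI[of _ "[r]"]) auto
  next
    case (Suc l)
    with cons.IH obtain hs where "peg_move B Q (r # hs) R" "length hs = k" by auto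
    with peg_move.more[OF cons.hyps(1)] show ?thesis by (intro exI[of _ "r # hs"]) auto
  qed
qed

definition along :: "hole \<Rightarrow> hole \<Rightarrow> nat \<Rightarrow> hole" where
  "along p d j = (fst p + int j * fst d, snd p + int j * snd d)"

lemma along_eq_iff: "d \<in> directions \<Longrightarrow> along p d j = along p d k \<longleftrightarrow> j = k"
  by (auto simp: along_def directions_def)

lemma along_Suc: "along p d (Suc j) = along p d j + d"
  by (cases d) (auto simp: along_def algebra_simps)

text \<open>The peg captures the odd indices and lands on the even ones. Index 0 is its own start,
  so emptiness is required from index 2 on.\<close>

lemma line_sweeps:
  assumes d: "d \<in> directions"
    and "\<And>j. j \<le> 2 * k \<Longrightarrow> along p d j \<in> B"
    and "p \<in> P"
    and "\<And>j. j < k \<Longrightarrow> along p d (2 * j + 1) \<in> P"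
    and "\<And>j. j < k \<Longrightarrow> along p d (2 * j + 2) \<notin> P"
  shows "sweeps B P p (along p d (2 * k)) k
           (insert (along p d (2 * k)) (P - {p} - (\<lambda>j. along p d (2 * j + 1)) ` {..<k}))"
  using assms(2-5)
proof (induction k)
  case 0
  have "along p d 0 = p" by (simp add: along_def)
  then show ?case using 0 by (simp add: insert_absorb sweeps.nil)
next
  case (Suc k)
  let ?Q = "insert (along p d (2 * k)) (P - {p} - (\<lambda>j. along p d (2 * j + 1)) ` {..<k})"
  let ?R = "insert (along p d (2 * Suc k)) (P - {p} - (\<lambda>j. along p d (2 * j + 1)) ` {..<Suc k})"
  have p: "p = along p d 0" by (simp add: along_def)
  have s: "sweeps B P p (along p d (2 * k)) k ?Q"
    by (rule Suc.IH) (use Suc.prems in auto)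
  have e: "along p d (2 * k) + d = along p d (2 * k + 1)"
    "along p d (2 * k + 1) + d = along p d (2 * k + 2)"
    using along_Suc[of p d "2 * k"] along_Suc[of p d "2 * k + 1"] by simp_all
  have k: "along p d (2 * k) \<notin> P - {p}"
  proof (cases k)
    case 0
    then show ?thesis using p by simp
  next
    case (Suc l)
    then show ?thesis using Suc.prems(4)[of l] by simp
  qed
  have "along p d (2 * k + 1) \<in> ?Q"
    using Suc.prems(3)[of k] p along_eq_iff[OF d, of p "2 * k + 1" 0]
    by (auto simp: along_eq_iff[OF d])
  moreover have "along p d (2 * k + 2) \<notin> ?Q"
    using Suc.prems(4)[of k] by (auto simp: along_eq_iff[OF d])
  moreover have "?R = insert (along p d (2 * k + 2)) (?Q - {along p d (2 * k), along p d (2 * k + 1)})"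
    using k by (auto simp: lessThan_Suc)
  ultimately have "jump B ?Q (along p d (2 * k)) (along p d (2 * k + 2)) ?R"
    unfolding jump_def using d e Suc.prems(1)[of "2 * k"] Suc.prems(1)[of "2 * k + 1"]
      Suc.prems(1)[of "2 * k + 2"] by (intro bexI[of _ d]) simp_all
  with s have "sweeps B P p (along p d (2 * k + 2)) (Suc k) ?R" by (rule sweeps_snoc)
  then show ?case by simp
qed

subsection \<open>The longest sweep\<close>

text \<open>The peg lands only in \<open>C\<close> and jumps only over \<open>X\<close>. Each jump
  takes one peg from \<open>X\<close>, and the moving peg, staying in \<open>C\<close>, never adds
  one.\<close>

lemma peg_move_length_le:
  assumes "peg_move B P s Q" "hd s \<in> C" "finite B" "P \<subseteq> B"
    and C: "\<And>p d. p \<in> C \<Longrightarrow> d \<in> directions \<Longrightarrow> p + d + d \<in> B \<Longrightarrow> p + d + d \<in> C"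
    and X: "\<And>p d. p \<in> C \<Longrightarrow> d \<in> directions \<Longrightarrow> p + d + d \<in> C \<Longrightarrow> p + d \<in> X"
    and "X \<inter> C = {}"
  shows "length s - 1 \<le> card (P \<inter> X)"
proof -
  have jump: "card (P \<inter> X) = Suc (card (Q \<inter> X)) \<and> q \<in> C \<and> Q \<subseteq> B"
    if J: "jump B P p q Q" "p \<in> C" "P \<subseteq> B" for P Q p q
  proof -
    from J obtain d where d: "d \<in> directions" "q = p + d + d" "p + d \<in> B" "q \<in> B"
      "p \<in> P" "p + d \<in> P" "q \<notin> P" "Q = insert q (P - {p, p + d})"
      unfolding jump_def by blast
    have q: "q \<in> C" and m: "p + d \<in> X" using C X J(2) d by auto
    have "P \<inter> X = insert (p + d) (Q \<inter> X)" "p + d \<notin> Q \<inter> X"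
      using q m d J(2) \<open>X \<inter> C = {}\<close> by auto
    moreover have "finite (Q \<inter> X)"
      using d(8) J(3) \<open>finite B\<close> by (auto intro: finite_subset)
    ultimately show ?thesis using q d J(3) by auto
  qed
  from assms(1,2,4) show ?thesis
  proof (induction rule: peg_move.induct)
    case (single P p q Q)
    then show ?case using jump[OF single.hyps] by simp
  next
    case (more P p q Q hs R)
    then show ?case using jump[OF more.hyps(1)] by fastforce
  qed
qed

text \<open>In the box spanned by an \<open>m\<close> by \<open>m\<close> grid of spacing 2, the
  holes off the grid are the midpoints of its edges.\<close>

lemma card_odd_positions:
  fixes u v :: int
  assumes "m > 0"
  shows "card ({1 + u..2 * int m - 1 + u} \<times> {1 + v..2 * int m - 1 + v} -
           (\<lambda>k. 1 + u + 2 * int k) ` {..<m} \<times> (\<lambda>k. 1 + v + 2 * int k) ` {..<m})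
         = (2 * m - 1)\<^sup>2 - m\<^sup>2"
proof -
  have c: "card ((\<lambda>k. 1 + w + 2 * int k) ` {..<m}) = m" for w :: int
    by (subst card_image) (auto simp: inj_on_def)
  have i: "card {1 + w..2 * int m - 1 + w} = 2 * m - 1" for w :: int
    using assms by simp
  show ?thesis
    by (subst card_Diff_subset)
      (auto simp: c i card_cartesian_product power2_eq_square simp del: card_atLeastAtMost_int)
qed

lemma possible_sweep_length_le:
  assumes "possible_sweep (rhombus (2 * m)) s"
  shows "sweep_length s \<le> (2 * m - 1)\<^sup>2 - m\<^sup>2"
proof -
  let ?B = "rhombus (2 * m)"
  obtain P Q where PQ: "P \<subseteq> ?B" "peg_move ?B P s Q"
    using assms unfolding possible_sweep_def by blast
  obtain a b where ab: "hd s = (a, b)" by force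
  have "hd s \<in> ?B"
    using PQ(2) by (cases rule: peg_move.cases) (auto simp: jump_def)
  then have m: "m > 0" and ab': "1 \<le> a" "a \<le> 2 * int m" "1 \<le> b" "b \<le> 2 * int m"
    using ab by (auto simp: rhombus_def)
  \<comment> \<open>\<open>1 + u\<close> and \<open>1 + v\<close> are the smallest coordinates with
    the parities of the start; either parity occurs \<open>m\<close> times on a side.\<close>
  define u v :: int where "u = (if odd a then 0 else 1)" and "v = (if odd b then 0 else 1)"
  define C where "C = {(x, y). (x, y) \<in> ?B \<and> even (x - a) \<and> even (y - b)}"
  define X where "X = {1 + u..2 * int m - 1 + u} \<times> {1 + v..2 * int m - 1 + v} - C"
  have half: "x \<in> (\<lambda>k. 1 + w + 2 * int k) ` {..<m} \<longleftrightarrow> 1 \<le> x \<and> x \<le> 2 * int m \<and> even (x - c)"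
    if "w = (if odd c then 0 else 1)" for x w c :: int
  proof
    assume x: "1 \<le> x \<and> x \<le> 2 * int m \<and> even (x - c)"
    then have "even (x - 1 - w)" using that by (simp split: if_splits)
    then obtain e where e: "x - 1 - w = 2 * e" ..
    then have "0 \<le> e" "e < int m" using x that by (simp_all split: if_splits)
    then show "x \<in> (\<lambda>k. 1 + w + 2 * int k) ` {..<m}"
      using e by (intro image_eqI[of _ _ "nat e"]) auto
  qed (use that in \<open>auto split: if_splits\<close>)
  have C: "C = (\<lambda>k. 1 + u + 2 * int k) ` {..<m} \<times> (\<lambda>k. 1 + v + 2 * int k) ` {..<m}"
    unfolding C_def rhombus_def set_eq_iff
    by (simp only: mem_Times_iff half[OF u_def] half[OF v_def]) auto
  have "length s - 1 \<le> card (P \<inter> X)"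
  proof (rule peg_move_length_le[OF PQ(2) _ _ PQ(1)])
    show "hd s \<in> C" using \<open>hd s \<in> ?B\<close> ab by (simp add: C_def)
    show "finite ?B" by (simp add: rhombus_def)
    show "X \<inter> C = {}" by (auto simp: X_def)
    show "p + d + d \<in> C" if "p \<in> C" "d \<in> directions" "p + d + d \<in> ?B" for p d
      using that by (auto simp: C_def directions_def)
    show "p + d \<in> X" if p: "p \<in> C" and d: "d \<in> directions" and q: "p + d + d \<in> C" for p d
    proof -
      obtain x y where xy: "p = (x, y)" by force
      have b: "1 + u \<le> x" "x \<le> 2 * int m - 1 + u" "1 + v \<le> y" "y \<le> 2 * int m - 1 + v"
        using p unfolding C xy by auto
      obtain e f where ef: "d = (e, f)" by force
      have b': "1 + u \<le> x + e + e" "x + e + e \<le> 2 * int m - 1 + u"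
        "1 + v \<le> y + f + f" "y + f + f \<le> 2 * int m - 1 + v"
        using q unfolding C xy ef by auto
      \<comment> \<open>Every direction has an odd coordinate, so a midpoint never has the parities
        of the ends.\<close>
      have "(x + e, y + f) \<notin> C"
        using p d unfolding xy ef C_def directions_def by auto
      then show ?thesis
        using b b' unfolding X_def xy ef by auto
    qed
  qed
  also have "\<dots> \<le> card X"
    by (rule card_mono) (auto simp: X_def)
  also have "\<dots> = (2 * m - 1)\<^sup>2 - m\<^sup>2"
    unfolding X_def C by (rule card_odd_positions[OF m])
  finally show ?thesis by (simp add: sweep_length_def)
qed

text \<open>For even \<open>n\<close>, the midpoints of the edges of the odd grid from row
  \<open>y\<close> upwards: what the sweep has still to capture.\<close>

definition lattice_gaps :: "int \<Rightarrow> int \<Rightarrow> hole set" where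
  "lattice_gaps n y = {(u, v). 1 \<le> u \<and> u < n \<and> y \<le> v \<and> v < n \<and> \<not> (odd u \<and> odd v)}"

text \<open>Jumps up to row \<open>y + 2\<close> alternate with diagonal jumps back to row
  \<open>y\<close>. The former capture the odd columns of row \<open>y + 1\<close>, the latter the
  even ones.\<close>

lemma zigzag_sweeps:
  assumes "\<And>x v. 1 \<le> x \<Longrightarrow> x \<le> 2 * int t + 1 \<Longrightarrow> y \<le> v \<Longrightarrow> v \<le> y + 2 \<Longrightarrow> (x, v) \<in> B"
    and "\<And>x v. (x, v) \<in> R \<Longrightarrow> v < y + 2 \<or> v = y + 2 \<and> odd x \<Longrightarrow> False"
  shows "sweeps B ({(2 * int t + 1, y)} \<union> {1..2 * int t + 1} \<times> {y + 1} \<union> R)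
           (2 * int t + 1, y) (1, y + 2) (2 * t + 1) (insert (1, y + 2) R)"
proof -
  have r: "(x, v) \<notin> R" if "v < y + 2" for x v
    using assms(2) that by blast
  have r': "(x, y + 2) \<notin> R" if "odd x" for x
    using assms(2) that by blast
  from assms(1) show ?thesis
  proof (induction t)
    case 0
    have "jump B ({(1, y)} \<union> {1..1} \<times> {y + 1} \<union> R) (1, y) (1, y + 2) (insert (1, y + 2) R)"
      unfolding jump_def using 0[of 1 y] 0[of 1 "y + 1"] 0[of 1 "y + 2"] r r'
      by (intro bexI[of _ "(0, 1)"]) (auto simp: directions_def)
    then show ?case by (auto intro: sweeps.intros)
  next
    case (Suc t)
    let ?x = "2 * int t + 3"
    let ?P = "{(?x, y)} \<union> {1..?x} \<times> {y + 1} \<union> R"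
    let ?Q = "{(?x, y + 2)} \<union> {1..2 * int t + 2} \<times> {y + 1} \<union> R"
    let ?R = "{(2 * int t + 1, y)} \<union> {1..2 * int t + 1} \<times> {y + 1} \<union> R"
    have b: "(?x, y) \<in> B" "(?x, y + 1) \<in> B" "(?x, y + 2) \<in> B"
      "(2 * int t + 2, y + 1) \<in> B" "(2 * int t + 1, y) \<in> B"
      by (rule Suc.prems; simp)+
    then have b': "(2 + 2 * int t, 1 + y) \<in> B" by (simp add: add.commute)
    have "jump B ?P (?x, y) (?x, y + 2) ?Q"
      unfolding jump_def using b r r'
      by (intro bexI[of _ "(0, 1)"]) (auto simp: directions_def)
    moreover have "jump B ?Q (?x, y + 2) (2 * int t + 1, y) ?R"
      unfolding jump_def using b b' r r'
      by (intro bexI[of _ "(-1, -1)"]) (auto simp: directions_def)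
    moreover have "sweeps B ?R (2 * int t + 1, y) (1, y + 2) (2 * t + 1) (insert (1, y + 2) R)"
      by (rule Suc.IH) (use Suc.prems in auto)
    ultimately have "sweeps B ?P (?x, y) (1, y + 2) (Suc (Suc (2 * t + 1))) (insert (1, y + 2) R)"
      by (blast intro: sweeps.intros)
    then show ?case by (simp add: algebra_simps)
  qed
qed

lemma row_sweeps:
  assumes "m > 0" "odd y" "1 \<le> y" "y < 2 * int m"
  shows "sweeps (rhombus (2 * m)) (insert (1, y) (lattice_gaps (2 * int m) y)) (1, y)
           (2 * int m - 1, y) (m - 1) (insert (2 * int m - 1, y) (lattice_gaps (2 * int m) (y + 1)))"
proof -
  let ?P = "insert (1, y) (lattice_gaps (2 * int m) y)"
  have al: "along (1, y) (1, 0) j = (1 + int j, y)" for j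
    by (simp add: along_def)
  have s: "sweeps (rhombus (2 * m)) ?P (1, y) (along (1, y) (1, 0) (2 * (m - 1))) (m - 1)
          (insert (along (1, y) (1, 0) (2 * (m - 1)))
             (?P - {(1, y)} - (\<lambda>j. along (1, y) (1, 0) (2 * j + 1)) ` {..<m - 1}))"
    by (rule line_sweeps)
      (use assms in \<open>auto simp: al rhombus_def lattice_gaps_def directions_def\<close>)
  have img: "(\<lambda>j. along (1, y) (1, 0) (2 * j + 1)) ` {..<m - 1}
      = {(u, v). v = y \<and> even u \<and> 1 \<le> u \<and> u < 2 * int m}" (is "?L = ?R")
  proof
    show "?L \<subseteq> ?R" by (auto simp: al)
    show "?R \<subseteq> ?L"
    proof (clarsimp simp: al image_iff)
      fix u :: int assume "even u" "1 \<le> u" "u < 2 * int m"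
      then show "\<exists>j\<in>{..<m - Suc 0}. u = 2 + 2 * int j"
        by (intro bexI[of _ "nat (u div 2 - 1)"]) (auto; presburger)+
    qed
  qed
  have e: "along (1, y) (1, 0) (2 * (m - 1)) = (2 * int m - 1, y)"
    using assms by (simp add: al of_nat_diff)
  \<comment> \<open>In an odd row all gaps lie in even columns, so the row is now exhausted.\<close>
  have "insert (2 * int m - 1, y) (?P - {(1, y)} - {(u, v). v = y \<and> even u \<and> 1 \<le> u \<and> u < 2 * int m})
      = insert (2 * int m - 1, y) (lattice_gaps (2 * int m) (y + 1))"
    using assms by (auto simp: lattice_gaps_def) presburger+
  with s show ?thesis unfolding e img by simp
qed

text \<open>Induction on the number \<open>r\<close> of remaining zigzags. Each brings
  \<open>m - 1\<close> jumps along a row and \<open>2 * m - 1\<close> in the zigzag; the top row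
  adds \<open>m - 1\<close>.\<close>

lemma lattice_sweeps:
  assumes "m > 0" "r < m"
  shows "sweeps (rhombus (2 * m))
           (insert (1, 2 * int (m - r) - 1) (lattice_gaps (2 * int m) (2 * int (m - r) - 1)))
           (1, 2 * int (m - r) - 1) (2 * int m - 1, 2 * int m - 1) (r * (3 * m - 2) + m - 1)
           {(2 * int m - 1, 2 * int m - 1)}"
  using assms(2)
proof (induction r)
  case 0
  have "lattice_gaps (2 * int m) (2 * int m) = {}" by (auto simp: lattice_gaps_def)
  then show ?case
    using row_sweeps[OF assms(1), of "2 * int m - 1"] assms(1) by simp
next
  case (Suc r)
  define y where "y = 2 * int (m - Suc r) - 1"
  have y: "odd y" "1 \<le> y" "y + 2 < 2 * int m" "2 * int (m - r) - 1 = y + 2"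
    using Suc.prems by (auto simp: y_def of_nat_diff)
  let ?R = "lattice_gaps (2 * int m) (y + 2)"
  have m: "2 * int (m - 1) + 1 = 2 * int m - 1" using assms(1) by (simp add: of_nat_diff)
  have row: "sweeps (rhombus (2 * m)) (insert (1, y) (lattice_gaps (2 * int m) y)) (1, y)
           (2 * int m - 1, y) (m - 1) (insert (2 * int m - 1, y) (lattice_gaps (2 * int m) (y + 1)))"
    by (rule row_sweeps) (use assms(1) y in auto)
  have gaps: "insert (2 * int m - 1, y) (lattice_gaps (2 * int m) (y + 1))
      = {(2 * int (m - 1) + 1, y)} \<union> {1..2 * int (m - 1) + 1} \<times> {y + 1} \<union> ?R"
    unfolding m using y(1,2,3) by (auto simp: lattice_gaps_def)
  have zig: "sweeps (rhombus (2 * m)) ({(2 * int (m - 1) + 1, y)} \<union> {1..2 * int (m - 1) + 1} \<times> {y + 1} \<union> ?R)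
      (2 * int (m - 1) + 1, y) (1, y + 2) (2 * (m - 1) + 1) (insert (1, y + 2) ?R)"
    by (rule zigzag_sweeps) (use y m in \<open>auto simp: rhombus_def lattice_gaps_def\<close>)
  have "sweeps (rhombus (2 * m)) (insert (1, y + 2) ?R) (1, y + 2)
      (2 * int m - 1, 2 * int m - 1) (r * (3 * m - 2) + m - 1) {(2 * int m - 1, 2 * int m - 1)}"
    using Suc.IH[unfolded y(4)] Suc.prems by (simp only: Suc_lessD)
  note s = sweeps_trans[OF sweeps_trans[OF row[unfolded gaps, unfolded m] zig[unfolded m]] this]
  have k: "m - 1 + (2 * (m - 1) + 1) + (r * (3 * m - 2) + m - 1) = Suc r * (3 * m - 2) + m - 1"
    using assms(1) by simp
  show ?case using s by (simp only: k y_def)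
qed

lemma maximal_sweep_exists:
  assumes "m > 1"
  shows "\<exists>s. peg_move (rhombus (2 * m)) (insert (1, 1) (lattice_gaps (2 * int m) 1)) s
                {(2 * int m - 1, 2 * int m - 1)}
           \<and> maximal_sweep (rhombus (2 * m)) s \<and> sweep_length s = (m - 1) * (3 * m - 1)"
proof -
  obtain j where j: "m = Suc j" using assms by (cases m) auto
  \<comment> \<open>The constructed length and the upper bound are the same polynomial;
    \<open>m = Suc j\<close> removes truncated subtraction.\<close>
  have len: "(m - 1) * (3 * m - 2) + m - 1 = (m - 1) * (3 * m - 1)"
    "(2 * m - 1)\<^sup>2 - m\<^sup>2 = (m - 1) * (3 * m - 1)"
    by (simp_all add: j power2_eq_square algebra_simps)
  have "sweeps (rhombus (2 * m)) (insert (1, 1) (lattice_gaps (2 * int m) 1)) (1, 1)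
      (2 * int m - 1, 2 * int m - 1) ((m - 1) * (3 * m - 1)) {(2 * int m - 1, 2 * int m - 1)}"
    using lattice_sweeps[of m "m - 1", unfolded len(1)] assms by simp
  from sweeps_peg_move[OF this] obtain hs where
    hs: "peg_move (rhombus (2 * m)) (insert (1, 1) (lattice_gaps (2 * int m) 1)) ((1, 1) # hs)
           {(2 * int m - 1, 2 * int m - 1)}" "length hs = (m - 1) * (3 * m - 1)"
    using assms by (auto simp: j)
  have "insert (1, 1) (lattice_gaps (2 * int m) 1) \<subseteq> rhombus (2 * m)"
    using assms by (auto simp: lattice_gaps_def rhombus_def)
  with hs(1) have "possible_sweep (rhombus (2 * m)) ((1, 1) # hs)"
    unfolding possible_sweep_def by blast
  moreover have "sweep_length s' \<le> (m - 1) * (3 * m - 1)"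
    if "possible_sweep (rhombus (2 * m)) s'" for s'
    using possible_sweep_length_le[OF that] by (simp only: len(2))
  ultimately show ?thesis
    unfolding maximal_sweep_def using hs by (intro exI[of _ "(1, 1) # hs"]) (simp add: sweep_length_def)
qed

subsection \<open>Sparse lines\<close>

text \<open>For even \<open>b - a\<close>, odd distance from \<open>a\<close> means odd distance
  from \<open>b\<close>, so a peg at either end can sweep the rail.\<close>

definition vrail :: "int \<Rightarrow> int \<Rightarrow> int \<Rightarrow> hole set" where
  "vrail x a b = {(x', y). x' = x \<and> a < y \<and> y < b \<and> odd (y - a)}"

definition hrail :: "int \<Rightarrow> int \<Rightarrow> int \<Rightarrow> hole set" where
  "hrail y a b = {(x, y'). y' = y \<and> a < x \<and> x < b \<and> odd (x - a)}"

lemma line_reach: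
  assumes d: "d \<in> directions" and B: "\<And>j. j \<le> 2 * k \<Longrightarrow> along p d j \<in> B"
  shows "reach B (insert p ((\<lambda>j. along p d (2 * j + 1)) ` {..<k})) {along p d (2 * k)}"
proof -
  let ?P = "insert p ((\<lambda>j. along p d (2 * j + 1)) ` {..<k})"
  have p: "p = along p d 0" by (simp add: along_def)
  have "2 * j + 2 \<noteq> 2 * i + (1::nat)" for i j by presburger
  then have "along p d (2 * j + 2) \<notin> ?P" for j
    by (subst (2) p) (auto simp: along_eq_iff[OF d])
  then have "sweeps B ?P p (along p d (2 * k)) k (insert (along p d (2 * k))
      (?P - {p} - (\<lambda>j. along p d (2 * j + 1)) ` {..<k}))"
    by (intro line_sweeps d B) auto
  moreover have "?P - {p} - (\<lambda>j. along p d (2 * j + 1)) ` {..<k} = {}" by blast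
  ultimately show ?thesis using sweeps_reach by metis
qed

lemma odd_steps_up:
  "(\<lambda>j. a + (2 * int j + 1)) ` {..<k} = {y. a < y \<and> y < a + 2 * int k \<and> odd (y - a)}"
    (is "?L = ?R")
proof
  show "?R \<subseteq> ?L"
  proof
    fix y assume "y \<in> ?R"
    then have y: "a < y" "y < a + 2 * int k" "odd (y - a)" by auto
    then obtain c where c: "y - a = 2 * c + 1" by (blast elim: oddE)
    with y show "y \<in> (\<lambda>j. a + (2 * int j + 1)) ` {..<k}"
      by (intro image_eqI[of _ _ "nat c"]) auto
  qed
qed auto

lemma odd_steps_down:
  "(\<lambda>j. a + 2 * int k - (2 * int j + 1)) ` {..<k} = {y. a < y \<and> y < a + 2 * int k \<and> odd (y - a)}"
    (is "?L = ?R")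
proof
  show "?R \<subseteq> ?L"
  proof
    fix y assume "y \<in> ?R"
    then have y: "a < y" "y < a + 2 * int k" "odd (y - a)" by auto
    then obtain c where c: "y - a = 2 * c + 1" by (blast elim: oddE)
    \<comment> \<open>The jumps start at the upper end, so the index is counted back from
      \<open>k - 1\<close>.\<close>
    with y show "y \<in> (\<lambda>j. a + 2 * int k - (2 * int j + 1)) ` {..<k}"
      by (intro image_eqI[of _ _ "k - 1 - nat c"]) (auto simp: of_nat_diff)
  qed
qed auto

lemma even_diffE:
  assumes "even (b - a)" "a \<le> (b::int)"
  obtains k where "b = a + 2 * int k"
proof -
  from assms(1) obtain c where "b - a = 2 * c" ..
  with assms(2) show ?thesis by (intro that[of "nat c"]) auto
qed

lemma vrail_image: "vrail x a b = Pair x ` {y. a < y \<and> y < b \<and> odd (y - a)}"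
  by (auto simp: vrail_def)

lemma hrail_image: "hrail y a b = (\<lambda>x. (x, y)) ` {x. a < x \<and> x < b \<and> odd (x - a)}"
  by (auto simp: hrail_def)

lemma sweep_up:
  assumes "even (b - a)" "a \<le> b"
  shows "reach ({x} \<times> {a..b}) (insert (x, a) (vrail x a b)) {(x, b)}"
proof -
  obtain k where k: "b = a + 2 * int k" using assms by (rule even_diffE)
  have "(\<lambda>j. along (x, a) (0, 1) (2 * j + 1)) ` {..<k} = vrail x a b"
    unfolding vrail_image k odd_steps_up[symmetric] image_image by (simp add: along_def algebra_simps)
  with line_reach[of "(0, 1)" k "(x, a)" "{x} \<times> {a..b}"] show ?thesis
    by (auto simp: along_def k directions_def)
qed

lemma sweep_down:
  assumes "even (b - a)" "a \<le> b"
  shows "reach ({x} \<times> {a..b}) (insert (x, b) (vrail x a b)) {(x, a)}"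
proof -
  obtain k where k: "b = a + 2 * int k" using assms by (rule even_diffE)
  have "(\<lambda>j. along (x, b) (0, -1) (2 * j + 1)) ` {..<k} = vrail x a b"
    unfolding vrail_image k odd_steps_down[symmetric] image_image by (simp add: along_def algebra_simps)
  with line_reach[of "(0, -1)" k "(x, b)" "{x} \<times> {a..b}"] show ?thesis
    by (auto simp: along_def k directions_def)
qed

lemma sweep_right:
  assumes "even (b - a)" "a \<le> b"
  shows "reach ({a..b} \<times> {y}) (insert (a, y) (hrail y a b)) {(b, y)}"
proof -
  obtain k where k: "b = a + 2 * int k" using assms by (rule even_diffE)
  have "(\<lambda>j. along (a, y) (1, 0) (2 * j + 1)) ` {..<k} = hrail y a b"
    unfolding hrail_image k odd_steps_up[symmetric] image_image by (simp add: along_def algebra_simps)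
  with line_reach[of "(1, 0)" k "(a, y)" "{a..b} \<times> {y}"] show ?thesis
    by (auto simp: along_def k directions_def)
qed

lemma sweep_left:
  assumes "even (b - a)" "a \<le> b"
  shows "reach ({a..b} \<times> {y}) (insert (b, y) (hrail y a b)) {(a, y)}"
proof -
  obtain k where k: "b = a + 2 * int k" using assms by (rule even_diffE)
  have "(\<lambda>j. along (b, y) (-1, 0) (2 * j + 1)) ` {..<k} = hrail y a b"
    unfolding hrail_image k odd_steps_down[symmetric] image_image by (simp add: along_def algebra_simps)
  with line_reach[of "(-1, 0)" k "(b, y)" "{a..b} \<times> {y}"] show ?thesis
    by (auto simp: along_def k directions_def)
qed

text \<open>Comparing sets makes the order of pegs in the lists irrelevant; for concrete data both
  premises are closed and decided by evaluation.\<close>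

lemma reach_by_exec:
  assumes "map_option (\<lambda>R. set R = set Y) (exec js X) = Some True"
    and "list_all (\<lambda>h. h \<in> B) (touched js)"
  shows "reach B (set X) (set Y)"
proof -
  from assms(1) obtain Z where Z: "exec js X = Some Z" "set Z = set Y" by auto
  have "set (touched js) \<subseteq> B" using assms(2) by (auto simp: list_all_iff)
  from exec_reach[OF Z(1) this] show ?thesis by (simp only: Z(2))
qed

subsection \<open>Blocks\<close>

text \<open>The peg \<open>(3,6)\<close> comes from clearing column 3 above the block;
  \<open>(5,6)\<close> is left at the foot of column 5 to clear that column.\<close>

lemma block_first [unfolded list.set]:
  "reach ({1..6} \<times> {1..6})
     (set [(1,1), (3,1), (5,1), (6,1), (1,3), (3,3), (5,3), (6,3), (1,5), (3,5), (5,5),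
      (3,6)])
     (set [(1,1), (2,1), (1,3), (1,5), (5,6)])"
  by (rule reach_by_exec[where js =
      "[((6,1),(-1,0)), ((3,6),(0,-1)), ((4,1),(-1,0)), ((3,4),(0,-1)), ((6,3),(-1,0)),
       ((3,2),(1,1)), ((5,4),(0,1))]"]; code_simp)

text \<open>\<open>(-1,-1)\<close> and \<open>(0,-1)\<close> are \<open>(5,5)\<close> and
  \<open>(6,5)\<close> of the previous block. The first jumps out over the second and finally
  returns, so only \<open>(6,5)\<close> is lost there.\<close>

lemma block_second [unfolded list.set]:
  "reach ({1..6} \<times> {1..6} \<union> {(-1,-1), (0,-1), (1,-1), (1,0)})
     (set [(-1,-1), (0,-1), (1,1), (2,1), (1,3), (1,5), (1,6)])
     (set [(-1,-1)])"
  by (rule reach_by_exec[where js =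
      "[((-1,-1),(1,0)), ((1,6),(0,-1)), ((1,4),(0,-1)), ((1,2),(0,-1)), ((2,1),(-1,-1)),
       ((1,-1),(-1,0))]"]; code_simp)

text \<open>For the case that the previous block is the first one: the final peg is
  \<open>(5,6)\<close> as seen from there, at the foot of its column 5.\<close>

lemma block_second_last [unfolded list.set]:
  "reach ({1..6} \<times> {1..6} \<union> {(-1,0), (0,1)})
     (set [(1,1), (2,1), (1,3), (1,5), (1,6)])
     (set [(-1,0)])"
  by (rule reach_by_exec[where js =
      "[((2,1),(-1,0)), ((1,6),(0,-1)), ((1,4),(0,-1)), ((1,2),(-1,-1))]"]; code_simp)

text \<open>The first block once its columns are gone; the surviving peg stands at the left end of
  the remaining bottom row.\<close>

lemma bottom_corner [unfolded list.set]:
  "reach ({1..6} \<times> {1..6})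
     (set [(3,1), (5,1), (1,3), (3,3), (5,3), (6,3), (1,5), (3,5), (5,5), (6,5), (1,6),
      (3,6)])
     (set [(6,1)])"
  by (rule reach_by_exec[where js =
      "[((6,3),(-1,0)), ((6,5),(-1,0)), ((4,5),(-1,0)), ((1,6),(0,-1)), ((1,3),(0,1)),
       ((1,5),(1,0)), ((3,6),(0,-1)), ((3,4),(0,-1)), ((4,3),(-1,-1)), ((2,1),(1,0)),
       ((4,1),(1,0))]"]; code_simp)

text \<open>The last block with its full top row and last column; \<open>(6,-1)\<close> and
  \<open>(6,0)\<close> remain from the last column below. The previous block is affected as in
  \<open>block_second\<close>.\<close>

lemma top_corner [unfolded list.set]:
  "reach ({1..6} \<times> {1..6} \<union> {(-1,-1), (0,-1), (1,-1), (1,0)} \<union> {(6,-1), (6,0)})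
     (set [(-1,-1), (0,-1), (6,-1), (6,0), (1,1), (3,1), (5,1), (6,1), (6,2), (1,3), (3,3),
      (5,3), (6,3), (6,4), (1,5), (3,5), (5,5), (6,5), (1,6), (2,6), (3,6), (4,6), (5,6),
      (6,6)])
     (set [(-1,-1)])"
  by (rule reach_by_exec[where js =
      "[((6,4),(-1,-1)), ((6,6),(0,-1)), ((3,1),(1,1)), ((6,1),(-1,0)), ((6,3),(-1,0)),
       ((6,-1),(0,1)), ((1,6),(0,-1)), ((3,6),(0,-1)), ((6,1),(0,1)), ((-1,-1),(1,0)),
       ((5,6),(-1,0)), ((3,4),(0,-1)), ((2,6),(1,0)), ((1,4),(0,-1)), ((1,2),(0,-1)),
       ((6,3),(0,1)), ((6,5),(-1,0)), ((4,6),(0,-1)), ((4,4),(0,-1)), ((4,1),(0,1)),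
       ((4,3),(-1,-1)), ((2,1),(-1,-1)), ((1,-1),(-1,0))]"]; code_simp)

lemma top_corner_last [unfolded list.set]:
  "reach ({1..6} \<times> {1..6} \<union> {(-1,0), (0,1)} \<union> {(6,-1), (6,0)})
     (set [(6,-1), (6,0), (1,1), (3,1), (5,1), (6,1), (6,2), (1,3), (3,3), (5,3), (6,3),
      (6,4), (1,5), (3,5), (5,5), (6,5), (1,6), (2,6), (3,6), (4,6), (5,6), (6,6)])
     (set [(-1,0)])"
  by (rule reach_by_exec[where js =
      "[((6,4),(-1,-1)), ((6,6),(0,-1)), ((3,1),(1,1)), ((6,1),(-1,0)), ((6,3),(-1,0)),
       ((6,-1),(0,1)), ((1,6),(0,-1)), ((3,6),(0,-1)), ((6,1),(0,1)), ((5,6),(-1,0)),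
       ((3,4),(0,-1)), ((2,6),(1,0)), ((1,4),(0,-1)), ((6,3),(0,1)), ((6,5),(-1,0)),
       ((4,6),(0,-1)), ((4,4),(0,-1)), ((4,1),(0,1)), ((4,3),(-1,-1)), ((2,1),(-1,0)),
       ((1,2),(-1,-1))]"]; code_simp)

text \<open>The entire complement for side 6, where there is only one block.\<close>

lemma small_board [unfolded list.set]:
  "reach ({1..6} \<times> {1..6})
     (set [(3,1), (5,1), (6,1), (6,2), (1,3), (3,3), (5,3), (6,3), (6,4), (1,5), (3,5),
      (5,5), (6,5), (1,6), (2,6), (3,6), (4,6), (5,6), (6,6)])
     (set [(4,6)])"
  by (rule reach_by_exec[where js =
      "[((6,1),(-1,0)), ((1,6),(0,-1)), ((6,6),(-1,-1)), ((6,4),(-1,-1)), ((6,2),(0,1)),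
       ((6,5),(0,-1)), ((4,1),(0,1)), ((4,4),(0,-1)), ((3,1),(1,1)), ((1,4),(0,-1)),
       ((4,6),(1,0)), ((2,6),(1,0)), ((6,3),(-1,0)), ((4,3),(-1,0)), ((1,2),(1,1)),
       ((3,4),(0,1)), ((3,6),(1,0)), ((6,6),(-1,0))]"]; code_simp)

section \<open>Clearing a block together with the columns above it\<close>

lemma hrail_small:
  "hrail y 1 3 = {(2, y)}" "hrail y 2 4 = {(3, y)}" "hrail y 4 6 = {(5, y)}"
  "hrail y 1 5 = {(2, y), (4, y)}"
  unfolding hrail_def by (auto; presburger)+

lemma one_to_six: "{1..6 :: int} = {1, 2, 3, 4, 5, 6}"
  by auto

text \<open>The peg \<open>(3, h)\<close> runs down column 3. Three jumps in the top row then leave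
  just the pegs that a run from \<open>(5, h)\<close> to \<open>(1, h)\<close> captures.\<close>

lemma third_column:
  assumes "even h" "h \<ge> 8"
  shows "reach ({3} \<times> {6..h} \<union> {1..6} \<times> {h}) (vrail 3 6 h \<union> {1..6} \<times> {h}) {(3, 6), (2, h), (4, h)}"
    (is "reach ?B _ _")
proof -
  have "reach ?B (vrail 3 6 h \<union> {1..6} \<times> {h}) {(3, 6), (1, h), (2, h), (4, h), (5, h), (6, h)}"
    by (rule reach_step[OF sweep_down[of h 6 3], where R = "{(1, h), (2, h), (4, h), (5, h), (6, h)}"])
      (use assms in \<open>auto simp: one_to_six\<close>)
  also have "reach ?B \<dots> {(3, 6), (3, h), (4, h), (5, h), (6, h)}"
    by (rule reach_step[OF sweep_right[of 3 1 h], where R = "{(3, 6), (4, h), (5, h), (6, h)}"])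
      (use assms in \<open>auto simp: hrail_small\<close>)
  also have "reach ?B \<dots> {(3, 6), (2, h), (5, h), (6, h)}"
    by (rule reach_step[OF sweep_left[of 4 2 h], where R = "{(3, 6), (5, h), (6, h)}"])
      (use assms in \<open>auto simp: hrail_small\<close>)
  also have "reach ?B \<dots> {(3, 6), (2, h), (4, h)}"
    by (rule reach_step[OF sweep_left[of 6 4 h], where R = "{(3, 6), (2, h)}"])
      (use assms in \<open>auto simp: hrail_small\<close>)
  finally show ?thesis .
qed

text \<open>A single peg does it all: up column 5, left along the top row, down column 1.\<close>

lemma outer_columns:
  assumes "even h" "h \<ge> 8"
  shows "reach ({1, 5} \<times> {6..h} \<union> {1..6} \<times> {h})
     (vrail 1 6 h \<union> vrail 5 6 h \<union> {(5, 6), (2, h), (4, h)}) {(1, 6)}"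
    (is "reach ?B _ _")
proof -
  have "reach ?B (vrail 1 6 h \<union> vrail 5 6 h \<union> {(5, 6), (2, h), (4, h)})
      (vrail 1 6 h \<union> {(5, h), (2, h), (4, h)})"
    by (rule reach_step[OF sweep_up[of h 6 5], where R = "vrail 1 6 h \<union> {(2, h), (4, h)}"])
      (use assms in \<open>auto simp: vrail_def\<close>)
  also have "reach ?B \<dots> (vrail 1 6 h \<union> {(1, h)})"
    by (rule reach_step[OF sweep_left[of 5 1 h], where R = "vrail 1 6 h"])
      (use assms in \<open>auto simp: vrail_def hrail_small\<close>)
  also have "reach ?B \<dots> {(1, 6)}"
    by (rule reach_step[OF sweep_down[of h 6 1], where R = "{}"]) (use assms in auto)
  finally show ?thesis .
qed

text \<open>A block at the origin with the three pegs that cleared its rows, the columns above it, and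
  the top row, at height \<open>h\<close>. In the steps below, the peg at \<open>(6, 5)\<close> has already
  been used up by the previous block, whence the holes \<open>(-1, -1)\<close> and \<open>(0, -1)\<close> of the next block.\<close>

definition strip :: "int \<Rightarrow> hole set" where
  "strip h = {1, 3, 5} \<times> {1, 3, 5} \<union> {(6, 1), (6, 3), (6, 5)}
     \<union> vrail 1 6 h \<union> vrail 3 6 h \<union> vrail 5 6 h \<union> {1..6} \<times> {h}"

text \<open>Each phase supplies a peg for the next: column 3 gives \<open>(3, 6)\<close> to the
  block, the block gives \<open>(5, 6)\<close> to columns 5 and 1, and these return
  \<open>(1, 6)\<close>.\<close>

lemma strip_reach:
  assumes "even h" "h \<ge> 8"
  shows "reach ({1..6} \<times> {1..h}) (strip h - {(6, 5)}) {(1, 1), (2, 1), (1, 3), (1, 5), (1, 6)}"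
    (is "reach ?B _ _")
proof -
  have "reach ?B (strip h - {(6, 5)}) ({1, 3, 5} \<times> {1, 3, 5} \<union> {(6, 1), (6, 3)} \<union> vrail 1 6 h
      \<union> vrail 5 6 h \<union> {(3, 6), (2, h), (4, h)})"
    by (rule reach_step[OF third_column[OF assms], where R =
          "{1, 3, 5} \<times> {1, 3, 5} \<union> {(6, 1), (6, 3)} \<union> vrail 1 6 h \<union> vrail 5 6 h"])
      (use assms in \<open>auto simp: strip_def vrail_def\<close>)
  also have "reach ?B \<dots> ({(1, 1), (2, 1), (1, 3), (1, 5)} \<union> (vrail 1 6 h \<union> vrail 5 6 h
      \<union> {(5, 6), (2, h), (4, h)}))"
    by (rule reach_step[OF block_first, where R = "vrail 1 6 h \<union> vrail 5 6 h \<union> {(2, h), (4, h)}"])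
      (use assms in \<open>auto simp: vrail_def\<close>)
  also have "reach ?B \<dots> {(1, 1), (2, 1), (1, 3), (1, 5), (1, 6)}"
    by (rule reach_step[OF outer_columns[OF assms], where R = "{(1, 1), (2, 1), (1, 3), (1, 5)}"])
      (use assms in auto)
  finally show ?thesis .
qed

text \<open>The previous block loses exactly its \<open>(6, 5)\<close> and so takes the form in
  which this one was met; hence the step can be iterated.\<close>

lemma strip_step:
  assumes "even h" "h \<ge> 8"
  shows "reach ({1..6} \<times> {1..h} \<union> {(-1, -1), (0, -1), (1, -1), (1, 0)})
     (strip h - {(6, 5)} \<union> {(-1, -1), (0, -1)}) {(-1, -1)}" (is "reach ?B _ _")
proof -
  have "reach ?B (strip h - {(6, 5)} \<union> {(-1, -1), (0, -1)})
      ({(1, 1), (2, 1), (1, 3), (1, 5), (1, 6)} \<union> {(-1, -1), (0, -1)})"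
    by (rule reach_frame[OF strip_reach[OF assms]]) (use assms in auto)
  also have "reach ?B \<dots> {(-1, -1)}"
    by (rule reach_step[OF block_second, where R = "{}"]) (use assms in auto)
  finally show ?thesis .
qed

lemma strip_step_last:
  assumes "even h" "h \<ge> 8"
  shows "reach ({1..6} \<times> {1..h} \<union> {(-1, 0), (0, 1)}) (strip h - {(6, 5)}) {(-1, 0)}" (is "reach ?B _ _")
proof -
  have "reach ?B (strip h - {(6, 5)}) {(1, 1), (2, 1), (1, 3), (1, 5), (1, 6)}"
    by (rule reach_mono[OF strip_reach[OF assms]]) (use assms in auto)
  also have "reach ?B \<dots> {(-1, 0)}"
    by (rule reach_step[OF block_second_last, where R = "{}"]) (use assms in auto)
  finally show ?thesis .
qed

text \<open>Here \<open>(5, 6)\<close> comes from the second block, so all columns are cleared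
  before the block itself; the surviving peg then runs along the bottom row.\<close>

lemma first_strip_reach:
  assumes "even n" "n \<ge> 8"
  shows "reach ({1..n} \<times> {1..n}) (strip n - {(1, 1), (6, 1)} \<union> {(5, 6)} \<union> hrail 1 6 n) {(n, 1)}"
    (is "reach ?B _ _")
proof -
  have "reach ?B (strip n - {(1, 1), (6, 1)} \<union> {(5, 6)} \<union> hrail 1 6 n)
      ({1, 3, 5} \<times> {1, 3, 5} - {(1, 1)} \<union> {(6, 3), (6, 5), (5, 6)} \<union> vrail 1 6 n
      \<union> vrail 5 6 n \<union> hrail 1 6 n \<union> {(3, 6), (2, n), (4, n)})"
    by (rule reach_step[OF third_column[OF assms], where R =
          "{1, 3, 5} \<times> {1, 3, 5} - {(1, 1)} \<union> {(6, 3), (6, 5), (5, 6)} \<union> vrail 1 6 n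
            \<union> vrail 5 6 n \<union> hrail 1 6 n"])
      (use assms in \<open>auto simp: strip_def vrail_def hrail_def\<close>)
  also have "reach ?B \<dots> ({1, 3, 5} \<times> {1, 3, 5} - {(1, 1)} \<union> {(6, 3), (6, 5), (3, 6), (1, 6)}
      \<union> hrail 1 6 n)"
    by (rule reach_step[OF outer_columns[OF assms], where R =
          "{1, 3, 5} \<times> {1, 3, 5} - {(1, 1)} \<union> {(6, 3), (6, 5), (3, 6)} \<union> hrail 1 6 n"])
      (use assms in \<open>auto simp: hrail_def\<close>)
  also have "reach ?B \<dots> (insert (6, 1) (hrail 1 6 n))"
    by (rule reach_step[OF bottom_corner, where R = "hrail 1 6 n"])
      (use assms in \<open>auto simp: hrail_def\<close>)
  also have "reach ?B \<dots> {(n, 1)}"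
    by (rule reach_mono[OF sweep_right[of n 6 1]]) (use assms in auto)
  finally show ?thesis .
qed

subsection \<open>The whole board\<close>

text \<open>Row \<open>y\<close> meets the \<open>6 \<times> 6\<close> blocks along the diagonal in the columns \<open>row_end y - 5\<close> to
  \<open>row_end y\<close>.\<close>

definition row_end :: "int \<Rightarrow> int" where
  "row_end y = 6 * ((y + 5) div 6)"

text \<open>Trades the division for a quotient with linear bounds, as linear arithmetic
  needs.\<close>

lemma row_endE:
  obtains q where "row_end y = 6 * q" "6 * q - 5 \<le> y" "y \<le> 6 * q"
proof (rule that[of "(y + 5) div 6"])
  show "6 * ((y + 5) div 6) - 5 \<le> y" "y \<le> 6 * ((y + 5) div 6)" by presburger+
qed (simp add: row_end_def)

text \<open>The first \<open>k\<close> strips in global coordinates, except that the bottom row is still uncleared (and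
  \<open>(1, 1)\<close> is empty).\<close>

definition strips :: "int \<Rightarrow> int \<Rightarrow> hole set" where
  "strips n k = {(x, y). y = n \<and> 1 \<le> x \<and> x \<le> 6 * k}
     \<union> {(x, y). odd y \<and> 1 < y \<and> y < n \<and> 1 \<le> x \<and> x \<le> 6 * k \<and> x \<le> row_end y \<and> (odd x \<or> x = row_end y)}
     \<union> {(x, y). y = 1 \<and> odd x \<and> 1 < x \<and> x < n}"

lemma mem_translate: "(x, y) \<in> (+) (a, b) ` S \<longleftrightarrow> (x - a, y - b) \<in> S"
  for x y a b :: int
proof
  assume "(x - a, y - b) \<in> S"
  then show "(x, y) \<in> (+) (a, b) ` S"
    by (intro image_eqI[of _ _ "(x - a, y - b)"]) simp_all
qed auto

text \<open>Turns the explicit union, suited to jumps, into arithmetic that can be compared with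
  \<open>strips\<close>.\<close>

lemma strip_iff:
  "(x, y) \<in> strip h \<longleftrightarrow> 1 \<le> x \<and> x \<le> 6 \<and> (y = h \<or>
     odd y \<and> 1 \<le> y \<and> (odd x \<and> (y \<le> 5 \<or> y < h) \<or> x = 6 \<and> y \<le> 5))"
  (is "?L \<longleftrightarrow> ?R")
proof
  show "?L \<Longrightarrow> ?R" unfolding strip_def vrail_def by auto
  assume R: ?R
  have x: "x = 1 \<or> x = 3 \<or> x = 5" if "odd x" using that R by presburger
  have y: "y = 1 \<or> y = 3 \<or> y = 5" if "odd y" "1 \<le> y" "y \<le> 5" using that by presburger
  from R consider "y = h" | "odd y" "1 \<le> y" "y \<le> 5" "odd x \<or> x = 6"
    | "odd y" "odd x" "5 < y" "y < h" by linarith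
  then show ?L
  proof cases
    case 1
    then show ?thesis using R unfolding strip_def by simp
  next
    case 2
    then show ?thesis using x y unfolding strip_def by blast
  next
    case 3
    then have "6 < y" by presburger
    then show ?thesis using 3 x unfolding strip_def vrail_def by auto
  qed
qed

lemma strips_first:
  assumes "even n" "n \<ge> 8"
  shows "strips n 1 = strip n - {(1, 1), (6, 1)} \<union> hrail 1 6 n"
proof -
  have "(x, y) \<in> strips n 1 \<longleftrightarrow> (x, y) \<in> strip n - {(1, 1), (6, 1)} \<union> hrail 1 6 n" for x y
  proof -
    obtain q where q: "row_end y = 6 * q" "6 * q - 5 \<le> y" "y \<le> 6 * q" by (rule row_endE)
    consider "q \<le> 0" | "q = 1" | "q \<ge> 2" by linarith
    then show ?thesis
    proof cases
      case 1
      then show ?thesis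
        unfolding strips_def hrail_def Un_iff Diff_iff strip_iff using q assms by auto
    next
      case 2
      have "x = 6" if "even x" "x = row_end y" using that q 2 by simp
      moreover have "y \<le> 5" if "odd y" using that q(3) 2 by presburger
      ultimately show ?thesis
        unfolding strips_def hrail_def Un_iff Diff_iff strip_iff using q 2 assms by auto
    next
      case 3
      then show ?thesis
        unfolding strips_def hrail_def Un_iff Diff_iff strip_iff using q assms by auto
    qed
  qed
  then show ?thesis by auto
qed

text \<open>Strip \<open>k\<close> is a standard strip moved to its diagonal block, which reduces
  its height to \<open>n - 6 * (k - 1)\<close>.\<close>

lemma strips_split:
  assumes "even n" "k \<ge> 2" "n \<ge> 6 * k + 2"
  shows "strips n k = strips n (k - 1) \<union> (+) (6 * (k - 1), 6 * (k - 1)) ` strip (n - 6 * (k - 1))"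
proof -
  have "(x, y) \<in> strips n k \<longleftrightarrow>
     (x, y) \<in> strips n (k - 1) \<union> (+) (6 * (k - 1), 6 * (k - 1)) ` strip (n - 6 * (k - 1))" for x y
  proof -
    obtain q where q: "row_end y = 6 * q" "6 * q - 5 \<le> y" "y \<le> 6 * q" by (rule row_endE)
    have par: "odd (x - 6 * (k - 1)) \<longleftrightarrow> odd x" "odd (y - 6 * (k - 1)) \<longleftrightarrow> odd y" by simp_all
    consider "y = n" | "y \<noteq> n" "q \<le> k - 1" | "y \<noteq> n" "q = k" | "y \<noteq> n" "q \<ge> k + 1" by linarith
    then show ?thesis
    proof cases
      case 1
      then show ?thesis
        unfolding strips_def Un_iff mem_translate strip_iff par using assms by auto
    next
      case 2
      then show ?thesis
        unfolding strips_def Un_iff mem_translate strip_iff par using q assms by auto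
    next
      case 3
      have "y \<le> 6 * k - 1" if "odd y" using that q(3) 3 by presburger
      then show ?thesis
        unfolding strips_def Un_iff mem_translate strip_iff par using q 3 assms by auto
    next
      case 4
      then show ?thesis
        unfolding strips_def Un_iff mem_translate strip_iff par using q assms by auto
    qed
  qed
  then show ?thesis by auto
qed

text \<open>Separates the strips from the next block: to the right of them only the bottom row
  remains.\<close>

lemma strips_region:
  assumes "(x, y) \<in> strips n k"
  shows "x \<le> 6 * k \<or> y = 1 \<and> x < n"
  using assms by (auto simp: strips_def)

text \<open>The pegs \<open>(6, 5)\<close> and \<open>(5, 5)\<close> of strip \<open>k\<close>,
  which serve the next block as \<open>(0, -1)\<close> and \<open>(-1, -1)\<close>.\<close>

lemma last_train:
  assumes "k \<ge> 2" "6 * k < n"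
  shows "(6 * k, 6 * k - 1) \<in> strips n k" "(6 * k - 1, 6 * k - 1) \<in> strips n k"
proof -
  have "row_end (6 * k - 1) = 6 * k" unfolding row_end_def by presburger
  then show "(6 * k, 6 * k - 1) \<in> strips n k" "(6 * k - 1, 6 * k - 1) \<in> strips n k"
    using assms by (auto simp: strips_def)
qed

lemma image_translate_Diff: "(+) t ` (A - B) = (+) t ` A - (+) t ` B"
  for t :: hole
  by (rule image_set_diff) (simp add: inj_on_def)

lemma strips_step:
  assumes "even n" "k \<ge> 3" "n \<ge> 6 * k + 2"
  shows "reach ({1..n} \<times> {1..n}) (strips n k - {(6 * k, 6 * k - 1)})
     (strips n (k - 1) - {(6 * (k - 1), 6 * (k - 1) - 1)})"
proof -
  define a where "a = 6 * (k - 1)"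
  let ?S = "strips n (k - 1)" and ?T = "(+) (a, a) ` strip (n - a)"
  have h: "even (n - a)" "n - a \<ge> 8" using assms by (auto simp: a_def)
  have split: "strips n k = ?S \<union> ?T"
    using strips_split[of n k] assms unfolding a_def by simp
  have in_S: "(a, a - 1) \<in> ?S" "(a - 1, a - 1) \<in> ?S"
    using last_train[of "k - 1" n] assms by (simp_all add: a_def)
  have p: "(6 * k, 6 * k - 1) = (a + 6, a + 5)" by (simp add: a_def)
  have notin_S: "(a + 6, a + 5) \<notin> ?S"
    using strips_region[of "a + 6" "a + 5" n "k - 1"] assms by (auto simp: a_def)
  show ?thesis unfolding p a_def[symmetric]
  \<comment> \<open>\<open>R\<close> omits the two pegs of the previous strip that take part in the
    step; of these, \<open>(a - 1, a - 1)\<close> is restored.\<close>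
  proof (rule reach_step[OF reach_translate[OF strip_step[OF h], of "(a, a)"],
        where R = "?S - {(a - 1, a - 1), (a, a - 1)}"])
    show "(+) (a, a) ` ({1..6} \<times> {1..n - a} \<union> {(-1, -1), (0, -1), (1, -1), (1, 0)})
        \<subseteq> {1..n} \<times> {1..n}"
      using assms by (auto simp: a_def)
    show "strips n k - {(a + 6, a + 5)} =
        (+) (a, a) ` (strip (n - a) - {(6, 5)} \<union> {(-1, -1), (0, -1)}) \<union> (?S - {(a - 1, a - 1), (a, a - 1)})"
      unfolding split image_Un image_translate_Diff using in_S notin_S by auto
    show "?S - {(a, a - 1)} = (+) (a, a) ` {(-1, -1)} \<union> (?S - {(a - 1, a - 1), (a, a - 1)})"
      using in_S by auto
    show "(?S - {(a - 1, a - 1), (a, a - 1)}) \<inter>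
        (+) (a, a) ` ({1..6} \<times> {1..n - a} \<union> {(-1, -1), (0, -1), (1, -1), (1, 0)}) = {}"
      using assms by (auto simp: a_def dest: strips_region)
  qed
qed

text \<open>After translation by \<open>(6, 6)\<close> these are the auxiliary holes
  \<open>(-1, 0)\<close> and \<open>(0, 1)\<close> of \<open>strip_step_last\<close>.\<close>

lemma strips_one_notin: "n \<ge> 8 \<Longrightarrow> (5, 6) \<notin> strips n 1" "n \<ge> 8 \<Longrightarrow> (6, 7) \<notin> strips n 1"
  by (auto simp: strips_def row_end_def)

lemma strips_two_step:
  assumes "even n" "n \<ge> 14"
  shows "reach ({1..n} \<times> {1..n}) (strips n 2 - {(12, 11)}) (strips n 1 \<union> {(5, 6)})"
proof -
  have h: "even (n - 6)" "n - 6 \<ge> 8" using assms by auto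
  have split: "strips n 2 = strips n 1 \<union> (+) (6, 6) ` strip (n - 6)"
    using strips_split[of n 2] assms by simp
  have notin: "(12, 11) \<notin> strips n 1"
    using strips_region[of 12 11 n 1] by auto
  show ?thesis
  proof (rule reach_step[OF reach_translate[OF strip_step_last[OF h], of "(6, 6)"], where R = "strips n 1"])
    show "(+) (6, 6) ` ({1..6} \<times> {1..n - 6} \<union> {(-1, 0), (0, 1)}) \<subseteq> {1..n} \<times> {1..n}"
      using assms by auto
    show "strips n 2 - {(12, 11)} = (+) (6, 6) ` (strip (n - 6) - {(6, 5)}) \<union> strips n 1"
      unfolding split image_translate_Diff using notin by auto
    show "strips n 1 \<union> {(5, 6)} = (+) (6, 6) ` {(-1, 0)} \<union> strips n 1" by auto
    show "strips n 1 \<inter> (+) (6, 6) ` ({1..6} \<times> {1..n - 6} \<union> {(-1, 0), (0, 1)}) = {}"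
      using assms strips_one_notin[of n] by (auto dest: strips_region)
  qed
qed

lemma strips_one_reach:
  assumes "even n" "n \<ge> 8"
  shows "reach ({1..n} \<times> {1..n}) (strips n 1 \<union> {(5, 6)}) {(n, 1)}"
proof -
  have "strips n 1 \<union> {(5, 6)} = strip n - {(1, 1), (6, 1)} \<union> {(5, 6)} \<union> hrail 1 6 n"
    unfolding strips_first[OF assms] by blast
  with first_strip_reach[OF assms] show ?thesis by simp
qed

text \<open>Strips are removed from the right. Strip 2 is the base case, since it hands
  \<open>(5, 6)\<close> to the first strip.\<close>

lemma strips_reach:
  assumes "even n" "k \<ge> 2" "n \<ge> 6 * k + 2"
  shows "reach ({1..n} \<times> {1..n}) (strips n k - {(6 * k, 6 * k - 1)}) {(n, 1)}"
  using assms(2,3)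
proof (induction k rule: int_ge_induct)
  case base
  then show ?case
    using reach_trans[OF strips_two_step strips_one_reach, of n] assms(1) by simp
next
  case (step k)
  have "reach ({1..n} \<times> {1..n}) (strips n (k + 1) - {(6 * (k + 1), 6 * (k + 1) - 1)})
      (strips n k - {(6 * k, 6 * k - 1)})"
    using strips_step[of n "k + 1"] step.hyps step.prems assms(1) by simp
  also have "reach ({1..n} \<times> {1..n}) \<dots> {(n, 1)}"
    using step.IH step.prems by simp
  finally show ?case .
qed

section \<open>The top right corner block, the last column and the rows\<close>

definition corner :: "hole set" where
  "corner = {(x, y). 1 \<le> x \<and> x \<le> 6 \<and> 1 \<le> y \<and> y \<le> 6 \<and> (x = 6 \<or> y = 6 \<or> odd x \<and> odd y)}"

lemma corner_eq:
  "corner = {(1, 1), (3, 1), (5, 1), (6, 1), (6, 2), (1, 3), (3, 3), (5, 3), (6, 3), (6, 4),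
     (1, 5), (3, 5), (5, 5), (6, 5), (1, 6), (2, 6), (3, 6), (4, 6), (5, 6), (6, 6)}"
proof -
  have odd: "x = 1 \<or> x = 3 \<or> x = 5" if "odd x" "1 \<le> x" "x \<le> 6" for x :: int
    using that by presburger
  have "corner = {1, 3, 5} \<times> {1, 3, 5} \<union> {6} \<times> {1..6} \<union> {1..6} \<times> {6}" (is "_ = ?R")
  proof
    show "corner \<subseteq> ?R"
    proof (rule subrelI)
      fix x y assume "(x, y) \<in> corner"
      then show "(x, y) \<in> ?R" using odd[of x] odd[of y] unfolding corner_def by force
    qed
    show "?R \<subseteq> corner" by (auto simp: corner_def)
  qed
  also have "\<dots> = {(1, 1), (3, 1), (5, 1), (6, 1), (6, 2), (1, 3), (3, 3), (5, 3), (6, 3), (6, 4),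
     (1, 5), (3, 5), (5, 5), (6, 5), (1, 6), (2, 6), (3, 6), (4, 6), (5, 6), (6, 6)}"
    by code_simp
  finally show ?thesis .
qed

text \<open>For \<open>k = 1\<close> the previous block is the first one and must receive
  \<open>(5, 6)\<close>; otherwise it must lose its \<open>(6, 5)\<close>.\<close>

lemma corner_reach:
  assumes "k \<ge> 1" "n = 6 * k + 6"
  shows "reach ({1..n} \<times> {1..n})
     (strips n k \<union> (+) (6 * k, 6 * k) ` corner \<union> {(n, n - 7), (n, n - 6)}) {(n, 1)}"
proof (cases "k = 1")
  case True
  have "reach ({1..n} \<times> {1..n}) (strips n k \<union> (+) (6 * k, 6 * k) ` corner \<union> {(n, n - 7), (n, n - 6)})
      (strips n 1 \<union> {(5, 6)})"
  proof (rule reach_step[OF reach_translate[OF top_corner_last, of "(6, 6)"], where R = "strips n 1"])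
    show "strips n 1 \<inter> (+) (6, 6) ` ({1..6} \<times> {1..6} \<union> {(-1, 0), (0, 1)} \<union> {(6, -1), (6, 0)}) = {}"
      using assms True strips_one_notin[of n] by (auto dest: strips_region)
  qed (use assms True in \<open>auto simp: corner_eq\<close>)
  also have "reach ({1..n} \<times> {1..n}) \<dots> {(n, 1)}"
    by (rule strips_one_reach) (use assms True in auto)
  finally show ?thesis .
next
  case False
  define a where "a = 6 * k"
  let ?S = "strips n k"
  have in_S: "(a, a - 1) \<in> ?S" "(a - 1, a - 1) \<in> ?S"
    using last_train[of k n] assms False by (simp_all add: a_def)
  have n: "n = a + 6" using assms by (simp add: a_def)
  have "reach ({1..n} \<times> {1..n}) (?S \<union> (+) (a, a) ` corner \<union> {(n, n - 7), (n, n - 6)})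
      (?S - {(a, a - 1)})"
  proof (rule reach_step[OF reach_translate[OF top_corner, of "(a, a)"],
        where R = "?S - {(a - 1, a - 1), (a, a - 1)}"])
    show "?S \<union> (+) (a, a) ` corner \<union> {(n, n - 7), (n, n - 6)} =
        (+) (a, a) ` {(-1,-1), (0,-1), (6,-1), (6,0), (1,1), (3,1), (5,1), (6,1), (6,2), (1,3), (3,3),
          (5,3), (6,3), (6,4), (1,5), (3,5), (5,5), (6,5), (1,6), (2,6), (3,6), (4,6), (5,6), (6,6)}
        \<union> (?S - {(a - 1, a - 1), (a, a - 1)})"
      using in_S unfolding corner_eq n by auto
    show "(?S - {(a - 1, a - 1), (a, a - 1)}) \<inter> (+) (a, a) ` ({1..6} \<times> {1..6}
        \<union> {(-1,-1), (0,-1), (1,-1), (1,0)} \<union> {(6,-1), (6,0)}) = {}"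
      using assms False by (auto simp: a_def dest: strips_region)
    show "?S - {(a, a - 1)} = (+) (a, a) ` {(-1, -1)} \<union> (?S - {(a - 1, a - 1), (a, a - 1)})"
      using in_S by auto
  qed (use assms False in \<open>auto simp: a_def\<close>)
  also have "reach ({1..n} \<times> {1..n}) (?S - {(a, a - 1)}) {(n, 1)}"
    unfolding a_def by (rule strips_reach) (use assms False in auto)
  finally show ?thesis by (simp add: a_def)
qed

text \<open>The rail holds the even rows of the last column. The peg \<open>(n, 1)\<close> stops at
  row \<open>n - 7\<close>, just below \<open>(n, n - 6)\<close>, because the corner block uses both
  pegs.\<close>

lemma last_column_reach:
  assumes "k \<ge> 1" "n = 6 * k + 6"
  shows "reach ({1..n} \<times> {1..n})
     (strips n k \<union> (+) (6 * k, 6 * k) ` corner \<union> insert (n, 1) (vrail n 1 (n - 5))) {(n, 1)}"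
proof -
  let ?R = "strips n k \<union> (+) (6 * k, 6 * k) ` corner \<union> {(n, n - 6)}"
  have rail: "vrail n 1 (n - 5) = vrail n 1 (n - 7) \<union> {(n, n - 6)}"
  proof -
    have "y = n - 6 \<or> y < n - 7" if "y < n - 5" "odd (y - 1)" for y
      using that assms(2) by presburger
    then show ?thesis using assms by (auto simp: vrail_def)
  qed
  have "reach ({1..n} \<times> {1..n})
      (strips n k \<union> (+) (6 * k, 6 * k) ` corner \<union> insert (n, 1) (vrail n 1 (n - 5)))
      (strips n k \<union> (+) (6 * k, 6 * k) ` corner \<union> {(n, n - 7), (n, n - 6)})"
  proof (rule reach_step[OF sweep_up[of "n - 7" 1 n], where R = ?R])
    show "?R \<inter> {n} \<times> {1..n - 7} = {}"
      using assms by (auto simp: corner_def dest: strips_region)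
    show "strips n k \<union> (+) (6 * k, 6 * k) ` corner \<union> insert (n, 1) (vrail n 1 (n - 5)) =
        insert (n, 1) (vrail n 1 (n - 7)) \<union> ?R"
      unfolding rail by blast
  qed (use assms in auto)
  also note corner_reach[OF assms]
  finally show ?thesis .
qed

text \<open>In the odd rows from 3 to \<open>n - 7\<close> the peg of the last column runs left to
  the edge of the diagonal block. Row 1 is left out, as \<open>(n, 1)\<close> has to clear the last
  column.\<close>

lemma rows_reach:
  assumes "k \<ge> 1" "n = 6 * k + 6"
  shows "reach ({1..n} \<times> {1..n})
     {(x, y). 1 \<le> x \<and> x \<le> n \<and> 1 \<le> y \<and> y \<le> n \<and> (x = n \<or> y = n \<or> odd x \<and> odd y \<and> (x, y) \<noteq> (1, 1))}
     (strips n k \<union> (+) (6 * k, 6 * k) ` corner \<union> insert (n, 1) (vrail n 1 (n - 5)))"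
    (is "reach ?B ?C ?D")
proof -
  define I where "I = {y. odd y \<and> 3 \<le> y \<and> y \<le> n - 7}"
  let ?F = "\<Union>y\<in>I. {row_end y..n} \<times> {y}"
  let ?X = "\<Union>y\<in>I. insert (n, y) (hrail y (row_end y) n)"
  let ?Y = "\<Union>y\<in>I. {(row_end y, y)}"
  have row_end: "even (row_end y)" "1 \<le> y \<Longrightarrow> 1 \<le> row_end y" "y \<le> n - 6 \<Longrightarrow> row_end y \<le> n - 6" for y
    by (rule row_endE[of y]; use assms in simp)+
  have le: "row_end y \<le> n - 6" "1 \<le> row_end y" if "y \<in> I" for y
    using row_end(2,3)[of y] that by (auto simp: I_def)
  have n: "even n" using assms by simp
  have "I \<subseteq> {0..n}" by (auto simp: I_def)
  then have "finite I" by (rule finite_subset) simp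
  then have "reach ?F ?X ?Y"
  proof (rule reach_UN)
    fix y assume y: "y \<in> I"
    show "reach ({row_end y..n} \<times> {y}) (insert (n, y) (hrail y (row_end y) n)) {(row_end y, y)}"
      by (rule sweep_left) (use le[OF y] n row_end(1)[of y] in simp_all)
    show "insert (n, y) (hrail y (row_end y) n) \<subseteq> {row_end y..n} \<times> {y}"
      "{(row_end y, y)} \<subseteq> {row_end y..n} \<times> {y}"
      using le[OF y] by (auto simp: hrail_def)
  qed auto
  moreover have "?F \<subseteq> ?B"
  proof (rule UN_least)
    fix y assume "y \<in> I"
    then show "{row_end y..n} \<times> {y} \<subseteq> ?B" using le[of y] by (auto simp: I_def)
  qed
  moreover have "?X \<subseteq> ?C"
  proof (rule UN_least)
    fix y assume "y \<in> I"
    then show "insert (n, y) (hrail y (row_end y) n) \<subseteq> ?C"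
      using le[of y] row_end(1)[of y] by (auto simp: I_def hrail_def)
  qed
  then have "?C = ?X \<union> (?C - ?X)" by blast
  moreover have "?D = ?Y \<union> (?C - ?X)"
  proof -
    \<comment> \<open>As \<open>row_end y\<close> is even, the rail of row \<open>y\<close> occupies
      the odd columns.\<close>
    have X: "(x, y) \<in> ?X \<longleftrightarrow> y \<in> I \<and> (x = n \<or> row_end y < x \<and> x < n \<and> odd x)" for x y
      using row_end(1)[of y] by (auto simp: hrail_def)
    have Y: "(x, y) \<in> ?Y \<longleftrightarrow> y \<in> I \<and> x = row_end y" for x y by auto
    have K: "(x, y) \<in> (+) (6 * k, 6 * k) ` corner \<longleftrightarrow>
        n - 5 \<le> x \<and> x \<le> n \<and> n - 5 \<le> y \<and> y \<le> n \<and> (x = n \<or> y = n \<or> odd x \<and> odd y)" for x y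
      unfolding mem_translate corner_def using assms(2) by auto
    have "(x, y) \<in> ?D \<longleftrightarrow> (x, y) \<in> ?Y \<union> (?C - ?X)" for x y
    proof -
      obtain q where q: "row_end y = 6 * q" "y \<le> 6 * q" by (rule row_endE)
      have I: "y \<in> I \<longleftrightarrow> odd y \<and> 3 \<le> y \<and> y \<le> n - 7" by (simp add: I_def)
      consider "y = n" | "y \<in> I" | "y = 1" | "even y" "y \<noteq> n" | "odd y" "n - 5 \<le> y" "y < n" "y \<noteq> 1"
        | "odd y" "y < 1 \<or> n < y"
      proof -
        have f: "odd y \<Longrightarrow> 1 < y \<Longrightarrow> 3 \<le> y" "odd y \<Longrightarrow> n - 7 < y \<Longrightarrow> n - 5 \<le> y"
          using n by presburger+
        show ?thesis
        proof (cases "even y")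
          case True
          then show ?thesis using that by blast
        next
          case False
          then have "1 < y \<Longrightarrow> 3 \<le> y" "n - 7 < y \<Longrightarrow> n - 5 \<le> y" "y \<noteq> n"
            using f n by blast+
          then have "y < 1 \<or> y = 1 \<or> 3 \<le> y \<and> y \<le> n - 7 \<or> n - 5 \<le> y \<and> y < n \<and> y \<noteq> 1 \<or> n < y"
            by linarith
          with False I show ?thesis using that by blast
        qed
      qed
      then show ?thesis
      proof cases
        case 1
        then show ?thesis
          unfolding Un_iff Diff_iff X Y K insert_iff vrail_def strips_def using I n assms by auto
      next
        case 2
        then show ?thesis
          unfolding Un_iff Diff_iff X Y K insert_iff vrail_def strips_def
          using I n assms le[of y] by auto
      next
        case 3
        then show ?thesis
          unfolding Un_iff Diff_iff X Y K insert_iff vrail_def strips_def using I n assms by auto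
      next
        case 4
        then show ?thesis
          unfolding Un_iff Diff_iff X Y K insert_iff vrail_def strips_def using I n assms by auto
      next
        case 5
        \<comment> \<open>In the rows of the corner block \<open>row_end y\<close> exceeds
          \<open>6 * k\<close>, so the strips meet them in odd columns only.\<close>
        then have "6 * k < row_end y" "y \<notin> I" using q I assms by auto
        with 5 show ?thesis
          unfolding Un_iff Diff_iff X Y K insert_iff vrail_def strips_def using n assms by auto
      next
        case 6
        then have "y \<notin> I" using I assms by auto
        moreover have "y \<noteq> 1" "y \<noteq> n" "\<not> (1 < y \<and> y < n)" "\<not> (1 < y \<and> y < n - 5)"
          "\<not> (1 \<le> y \<and> y \<le> n)" "\<not> (n - 5 \<le> y \<and> y \<le> n)"
          using 6 assms by auto
        ultimately show ?thesis
          unfolding Un_iff Diff_iff X Y K insert_iff vrail_def strips_def by simp blast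
      qed
    qed
    then have "p \<in> ?D \<longleftrightarrow> p \<in> ?Y \<union> (?C - ?X)" for p by (cases p) (simp only:)
    then show ?thesis by (rule set_eqI)
  qed
  moreover have "(?C - ?X) \<inter> ?F = {}"
  proof -
    \<comment> \<open>No peg of \<open>?C\<close> stands at \<open>row_end y\<close>, an even column
      before \<open>n\<close>; all pegs further right in the row belong to its sweep.\<close>
    have X: "(x, y) \<in> ?X" if "(x, y) \<in> ?C" "y \<in> I" "row_end y \<le> x" for x y
    proof (cases "x = n")
      case False
      with that have "odd x" "x < n" by (auto simp: I_def)
      moreover from \<open>odd x\<close> have "row_end y \<noteq> x" using row_end(1)[of y] by auto
      ultimately have "(x, y) \<in> hrail y (row_end y) n"
        using that(3) row_end(1)[of y] by (simp add: hrail_def)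
      with that(2) show ?thesis by blast
    qed (use that in auto)
    show ?thesis
    proof (rule equals0I)
      fix p assume p: "p \<in> (?C - ?X) \<inter> ?F"
      obtain x y where xy: "p = (x, y)" by force
      from IntD2[OF p] have "y \<in> I" "row_end y \<le> x" unfolding xy by auto
      from DiffD2[OF IntD1[OF p[unfolded xy]] X[OF DiffD1[OF IntD1[OF p[unfolded xy]]] this]]
      show False .
    qed
  qed
  ultimately show ?thesis by (rule reach_step)
qed

text \<open>The final peg \<open>v\<close> becomes the initial vacancy when complements are taken.
  For \<open>i = 1\<close> there are no strips, so that board is treated separately.\<close>

lemma single_vacancy_reach:
  assumes "n = 6 * i" "i > 0"
  shows "\<exists>v\<in>{1..n} \<times> {1..n}. reach ({1..n} \<times> {1..n})
     {(x, y). 1 \<le> x \<and> x \<le> n \<and> 1 \<le> y \<and> y \<le> n \<and> (x = n \<or> y = n \<or> odd x \<and> odd y \<and> (x, y) \<noteq> (1, 1))}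
     {v}"
proof (cases "i = 1")
  case True
  have "{(x, y). 1 \<le> x \<and> x \<le> n \<and> 1 \<le> y \<and> y \<le> n \<and> (x = n \<or> y = n \<or> odd x \<and> odd y \<and> (x, y) \<noteq> (1, 1))}
      = corner - {(1, 1)}"
    using assms True by (auto simp: corner_def)
  also have "\<dots> = {(3, 1), (5, 1), (6, 1), (6, 2), (1, 3), (3, 3), (5, 3), (6, 3), (6, 4),
     (1, 5), (3, 5), (5, 5), (6, 5), (1, 6), (2, 6), (3, 6), (4, 6), (5, 6), (6, 6)}"
    unfolding corner_eq by simp
  finally show ?thesis
    using small_board assms True by (intro bexI[of _ "(4, 6)"]) auto
next
  case False
  define k where "k = i - 1"
  have k: "k \<ge> 1" "n = 6 * k + 6" using assms False by (simp_all add: k_def)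
  from reach_trans[OF rows_reach[OF k] last_column_reach[OF k]] show ?thesis
    using k by (intro bexI[of _ "(n, 1)"]) auto
qed

theorem mainTheorem1:
  fixes i :: nat
  assumes "i > 0"
  shows "\<exists>v ss. solution (rhombus (6 * i)) v ss \<and> ss \<noteq> [] \<and>
           maximal_sweep (rhombus (6 * i)) (last ss) \<and>
           sweep_length (last ss) = (9 * i - 1) * (3 * i - 1)"
proof -
  define n where "n = 6 * int i"
  let ?B = "rhombus (6 * i)" and ?E = "insert (1, 1) (lattice_gaps n 1)"
  have B: "?B = {1..n} \<times> {1..n}" by (simp add: rhombus_def n_def)
  \<comment> \<open>The side \<open>6 * i\<close> is \<open>2 * m\<close> with
    \<open>m = 3 * i\<close>.\<close>
  obtain s h where s: "peg_move ?B ?E s {h}" "maximal_sweep ?B s"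
    "sweep_length s = (9 * i - 1) * (3 * i - 1)"
    using maximal_sweep_exists[of "3 * i"] assms by (auto simp: n_def mult.commute)
  have n: "n \<ge> 6" using assms by (simp add: n_def)
  have E: "?E \<subseteq> ?B"
    using n by (auto simp: B lattice_gaps_def)
  have "?B - ?E = {(x, y). 1 \<le> x \<and> x \<le> n \<and> 1 \<le> y \<and> y \<le> n
      \<and> (x = n \<or> y = n \<or> odd x \<and> odd y \<and> (x, y) \<noteq> (1, 1))}"
    using n unfolding B by (auto simp: lattice_gaps_def)
  then obtain v where v: "v \<in> ?B" "reach ?B (?B - ?E) {v}"
    using single_vacancy_reach[OF n_def] assms unfolding B by auto
  \<comment> \<open>Complements reverse the jumps, which now end in \<open>?E\<close>, where the
    sweep starts.\<close>
  have "reach ?B (?B - {v}) ?E"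
    using reach_complement[OF v(2)] E by (simp add: double_diff)
  moreover have "play ?B ?E [s] {h}"
    using s(1) by (auto intro: play.intros)
  ultimately obtain ts where "play ?B (?B - {v}) (ts @ [s]) {h}"
    using reach_play_append by blast
  then have "solution ?B v (ts @ [s])"
    using v(1) unfolding solution_def by blast
  with s(2,3) show ?thesis
    by (intro exI[of _ v] exI[of _ "ts @ [s]"]) simp
qed

end
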